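(* Let $n\ge 1$. Assume that the log-Brunn-Minkowski inequality holds in dimension $n$ for the Lebesgue measure, i.e. for all symmetric convex bodies $K,L$ in $\mathbb{R}^n$ and all $\lambda\in(0,1)$, $$|\lambda\cdot K+_0(1-\lambda)\cdot L|\ \geq\ |K|^{\lambda}|L|^{1-\lambda}.$$ Then the log-Brunn-Minkowski inequality holds in dimension $n$ for every even log-concave density, i.e. for every measure $\mu$ on $\mathbb{R}^n$ with an even log-concave density, all symmetric convex bodies $K,L$ in $\mathbb{R}^n$ and all $\lambda\in(0,1)$, $$\mu\big(\lambda\cdot K+_0(1-\lambda)\cdot L\big)\ \geq\ \mu(K)^{\lambda}\mu(L)^{1-\lambda}.$$
   Context: A convex body in $\mathbb{R}^n$ is a compact convex set with non-empty interior; it is symmetric if $K=-K$. $|\cdot|$ is $n$-dimensional Lebesgue measure. The support function of $K$ is $h_K(u)=\max_{y\in K}x\cdot y$ evaluated at $x=u$, i.e. $h_K(u)=\max_{y\in K}u\cdot y$. For convex bodies $K,L$ containing the origin in their interiors and $\lambda\in(0,1)$, the logarithmic sum is $$\lambda\cdot K+_0(1-\lambda)\cdot L=\{x\in\mathbb{R}^n : x\cdot u\le h_K(u)^{\lambda}h_L(u)^{1-\lambda}\ \text{for all } u\in S^{n-1}\}.$$ A function $f:\mathbb{R}^n\to[0,\infty)$ is log-concave if $\log f$ (with values in $[-\infty,\infty)$) is concave; it is even if $f(-x)=f(x)$. A measure $\mu$ has density $f$ if $d\mu=f\,dx$. *)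

theory Defs
  imports "HOL-Analysis.Analysis"
begin

definition convex_body :: "'a::euclidean_space set \<Rightarrow> bool" where
  "convex_body K \<longleftrightarrow> compact K \<and> convex K \<and> interior K \<noteq> {}"

definition symmetric_body :: "'a::euclidean_space set \<Rightarrow> bool" where
  "symmetric_body K \<longleftrightarrow> convex_body K \<and> K = uminus ` K"

definition support_function :: "'a::euclidean_space set \<Rightarrow> 'a \<Rightarrow> real" where
  "support_function K u = (SUP y\<in>K. u \<bullet> y)"

text \<open>On a convex body the supremum above is a maximum.\<close>

lemma support_function_attained:
  assumes "convex_body K"
  shows "\<exists>y\<in>K. support_function K u = u \<bullet> y \<and> (\<forall>z\<in>K. u \<bullet> z \<le> u \<bullet> y)"
proof -
  have "compact K" "K \<noteq> {}"
    using assms by (auto simp: convex_body_def)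
  moreover have "continuous_on K (\<lambda>y. u \<bullet> y)"
    by (intro continuous_intros)
  ultimately obtain y where y: "y \<in> K" "\<forall>z\<in>K. u \<bullet> z \<le> u \<bullet> y"
    by (meson continuous_attains_sup)
  then have "support_function K u = u \<bullet> y"
    unfolding support_function_def by (intro cSup_eq_maximum) auto
  with y show ?thesis by blast
qed

definition log_sum :: "real \<Rightarrow> 'a::euclidean_space set \<Rightarrow> 'a set \<Rightarrow> 'a set" where
  "log_sum t K L =
     {x. \<forall>u\<in>sphere 0 1. x \<bullet> u \<le> support_function K u powr t * support_function L u powr (1 - t)}"

definition log_brunn_minkowski :: "'a::euclidean_space measure \<Rightarrow> bool" where
  "log_brunn_minkowski M \<longleftrightarrow>
     (\<forall>K L t. symmetric_body K \<longrightarrow> symmetric_body L \<longrightarrow> 0 < t \<longrightarrow> t < 1 \<longrightarrow>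
        measure M (log_sum t K L) \<ge> measure M K powr t * measure M L powr (1 - t))"

text \<open>The logarithm of a nonnegative real, with value \<open>-\<infinity>\<close> at \<open>0\<close>.\<close>

definition ext_ln :: "real \<Rightarrow> ereal" where
  "ext_ln r = (if r = 0 then -\<infinity> else ereal (ln r))"

definition log_concave_fun :: "('a::euclidean_space \<Rightarrow> real) \<Rightarrow> bool" where
  "log_concave_fun f \<longleftrightarrow>
     (\<forall>x. 0 \<le> f x) \<and>
     (\<forall>x y t. 0 < t \<longrightarrow> t < 1 \<longrightarrow>
        ext_ln (f ((1 - t) *\<^sub>R x + t *\<^sub>R y)) \<ge> ereal (1 - t) * ext_ln (f x) + ereal t * ext_ln (f y))"

definition even_fun :: "('a::euclidean_space \<Rightarrow> real) \<Rightarrow> bool" where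
  "even_fun f \<longleftrightarrow> (\<forall>x. f (- x) = f x)"

end

theory Submission
  imports Defs
begin

text \<open>
  By Tonelli, \<open>\<mu> S\<close> is the integral over the real line of \<open>exp (-x) * |S \<inter> {f \<ge> exp (-x)}|\<close>.
  The logarithmic sum is monotone and, by the arithmetic-geometric mean inequality for support
  functions, contained in the Minkowski combination. As \<open>f\<close> is log-concave, it follows that
  the logarithmic sum of \<open>K \<inter> {f \<ge> r}\<close> and \<open>L \<inter> {f \<ge> s}\<close> lies, up to a
  null set, in the logarithmic sum of \<open>K\<close> and \<open>L\<close> intersected with
  \<open>{f \<ge> r powr t * s powr (1 - t)}\<close>. The assumed inequality for Lebesgue
  measure therefore gives exactly the hypothesis of the one-dimensional Prekopa-Leindler inequality
  for the three integrands.
\<close>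

section \<open>The Brunn-Minkowski inequality on the real line\<close>

lemma emeasure_lborel_vimage_minus:
  fixes A :: "real set"
  assumes "A \<in> sets borel"
  shows "emeasure lborel ((\<lambda>x. x - c) -` A) = emeasure lborel A"
proof -
  have "emeasure (distr lborel borel ((+) (-c))) A = emeasure lborel (((+) (-c)) -` A)"
    using assms by (subst emeasure_distr) auto
  moreover have "((+) (-c)) -` A = (\<lambda>x. x - c) -` A" by auto
  ultimately show ?thesis by (simp add: lborel_distr_plus)
qed

text \<open>For \<open>a\<close> close to \<open>Sup A\<close> and \<open>b\<close> close to
  \<open>Inf B\<close>, the translates \<open>A + b\<close> and \<open>B + a\<close> both lie in
  \<open>S\<close> and overlap only in a short interval, so their measures add up to arbitrary
  precision. Near-extremal points are used because the extrema need not be attained.\<close>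

lemma brunn_minkowski_real_bounded:
  fixes A B S :: "real set"
  assumes [measurable]: "A \<in> sets borel" "B \<in> sets borel" "S \<in> sets borel"
    and "A \<noteq> {}" "B \<noteq> {}" "bdd_above A" "bdd_below B"
    and sum: "\<And>a b. a \<in> A \<Longrightarrow> b \<in> B \<Longrightarrow> a + b \<in> S"
  shows "emeasure lborel A + emeasure lborel B \<le> emeasure lborel S"
proof (rule ennreal_le_epsilon)
  fix e :: real assume "0 < e"
  obtain a where a: "a \<in> A" "Sup A - e/2 < a"
    using less_cSupD[of A "Sup A - e/2"] \<open>0 < e\<close> \<open>A \<noteq> {}\<close> by auto
  obtain b where b: "b \<in> B" "b < Inf B + e/2"
    using cInf_lessD[of B "Inf B + e/2"] \<open>0 < e\<close> \<open>B \<noteq> {}\<close> by auto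
  \<comment> \<open>\<open>P\<close> is \<open>A + b\<close> and \<open>Q\<close> is
    \<open>B + a\<close>, written as preimages so that measurability is immediate.\<close>
  define P where "P = (\<lambda>x. x - b) -` A"
  define Q where "Q = (\<lambda>x. x - a) -` B"
  have [measurable]: "P \<in> sets borel" "Q \<in> sets borel"
    unfolding P_def Q_def by (auto intro!: measurable_sets_borel[OF _ assms(1)] measurable_sets_borel[OF _ assms(2)])
  have PQ: "P \<inter> Q \<subseteq> {a + Inf B .. Sup A + b}"
  proof
    fix x assume "x \<in> P \<inter> Q"
    then have "x - b \<le> Sup A" "Inf B \<le> x - a"
      using assms by (auto simp: P_def Q_def intro: cSup_upper cInf_lower)
    then show "x \<in> {a + Inf B .. Sup A + b}" by auto
  qed
  have "emeasure lborel (P \<inter> Q) \<le> emeasure lborel {a + Inf B .. Sup A + b}"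
    by (rule emeasure_mono[OF PQ]) auto
  \<comment> \<open>The length is \<open>(Sup A - a) + (b - Inf B)\<close>, and each summand is
    below \<open>e/2\<close>.\<close>
  also have "\<dots> \<le> ennreal e"
    using a b \<open>0 < e\<close> by (auto simp: emeasure_lborel_Icc_eq intro!: ennreal_leI)
  finally have I: "emeasure lborel (P \<inter> Q) \<le> ennreal e" .
  have sub: "(P - Q) \<union> Q \<subseteq> S"
  proof
    fix x assume "x \<in> (P - Q) \<union> Q"
    then show "x \<in> S"
      using sum[of "x - b" b] sum[of a "x - a"] a b by (auto simp: P_def Q_def)
  qed
  have "emeasure lborel A + emeasure lborel B = emeasure lborel P + emeasure lborel Q"
    by (simp add: P_def Q_def emeasure_lborel_vimage_minus)
  also have "emeasure lborel P = emeasure lborel (P - Q) + emeasure lborel (P \<inter> Q)"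
    by (subst plus_emeasure) (auto intro!: arg_cong[where f = "emeasure lborel"])
  also have "emeasure lborel (P - Q) + emeasure lborel (P \<inter> Q) + emeasure lborel Q
      = emeasure lborel ((P - Q) \<union> Q) + emeasure lborel (P \<inter> Q)"
    by (subst plus_emeasure[symmetric]) (auto simp: ac_simps)
  also have "\<dots> \<le> emeasure lborel S + ennreal e"
    using sub I by (intro add_mono emeasure_mono) auto
  finally show "emeasure lborel A + emeasure lborel B \<le> emeasure lborel S + ennreal e" .
qed

text \<open>The one-sided bounds are removed by exhausting \<open>A\<close> from the left and
  \<open>B\<close> from the right and passing to the limit by continuity from below.\<close>

lemma brunn_minkowski_real:
  fixes A B S :: "real set"
  assumes [measurable]: "A \<in> sets borel" "B \<in> sets borel" "S \<in> sets borel"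
    and "A \<noteq> {}" "B \<noteq> {}"
    and sum: "\<And>a b. a \<in> A \<Longrightarrow> b \<in> B \<Longrightarrow> a + b \<in> S"
  shows "emeasure lborel A + emeasure lborel B \<le> emeasure lborel S"
proof -
  obtain a b where ab: "a \<in> A" "b \<in> B" using assms by auto
  \<comment> \<open>Truncating relative to chosen points \<open>a\<close> and \<open>b\<close> keeps
    every \<open>A' n\<close> and \<open>B' n\<close> nonempty.\<close>
  define A' where "A' n = A \<inter> {..a + real n}" for n
  define B' where "B' n = B \<inter> {b - real n..}" for n
  have incA: "incseq A'" and incB: "incseq B'"
    by (auto simp: A'_def B'_def incseq_def)
  have UA: "(\<Union>n. A' n) = A"
  proof -
    have "\<exists>n. x \<le> a + real n" for x using real_arch_simple[of "x - a"] by (auto simp: algebra_simps)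
    then show ?thesis by (auto simp: A'_def)
  qed
  have UB: "(\<Union>n. B' n) = B"
  proof -
    have "\<exists>n. b \<le> x + real n" for x using real_arch_simple[of "b - x"] by (auto simp: algebra_simps)
    then show ?thesis by (auto simp: B'_def diff_le_eq)
  qed
  have meas[measurable]: "A' n \<in> sets borel" "B' n \<in> sets borel" for n
    by (auto simp: A'_def B'_def)
  have "emeasure lborel A + emeasure lborel B
      = (SUP n. emeasure lborel (A' n)) + (SUP n. emeasure lborel (B' n))"
    using SUP_emeasure_incseq[of A' lborel] SUP_emeasure_incseq[of B' lborel] incA UA incB UB meas
    by (simp add: image_subset_iff)
  also have "\<dots> = (SUP n. emeasure lborel (A' n) + emeasure lborel (B' n))"
    using incA incB meas
    by (intro ennreal_SUP_add[symmetric] monoI emeasure_mono) (simp_all add: incseqD)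
  also have "\<dots> \<le> emeasure lborel S"
  proof (intro SUP_least brunn_minkowski_real_bounded)
    fix n
    show "A' n \<noteq> {}" "B' n \<noteq> {}" using ab by (auto simp: A'_def B'_def)
    show "bdd_above (A' n)" "bdd_below (B' n)" by (auto simp: A'_def B'_def)
    show "a + b \<in> S" if "a \<in> A' n" "b \<in> B' n" for a b
      using that sum by (auto simp: A'_def B'_def)
  qed auto
  finally show ?thesis .
qed

section \<open>Layer-cake formula and the Prekopa-Leindler inequality on the real line\<close>

lemma nn_integral_layer_cake:
  fixes f :: "real \<Rightarrow> real"
  assumes [measurable]: "f \<in> borel_measurable borel"
  shows "(\<integral>\<^sup>+x. ennreal (f x) \<partial>lborel)
      = (\<integral>\<^sup>+a. emeasure lborel {x. a < f x} * indicator {0<..} a \<partial>lborel)"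
proof -
  have "(\<integral>\<^sup>+x. ennreal (f x) \<partial>lborel) = (\<integral>\<^sup>+x. (\<integral>\<^sup>+a. indicator {(x, a). 0 < a \<and> a < f x} (x, a) \<partial>lborel) \<partial>lborel)"
  proof (rule nn_integral_cong)
    fix x
    have "(\<integral>\<^sup>+a. indicator {(x, a). 0 < a \<and> a < f x} (x, a) \<partial>lborel) = (\<integral>\<^sup>+a. indicator {0<..<f x} a \<partial>lborel)"
      by (intro nn_integral_cong) (auto simp: indicator_def)
    also have "\<dots> = ennreal (f x)"
      by (cases "0 \<le> f x") (auto simp: ennreal_neg)
    finally show "ennreal (f x) = (\<integral>\<^sup>+a. indicator {(x, a). 0 < a \<and> a < f x} (x, a) \<partial>lborel)" ..
  qed
  also have "\<dots> = (\<integral>\<^sup>+a. (\<integral>\<^sup>+x. indicator {(x, a). 0 < a \<and> a < f x} (x, a) \<partial>lborel) \<partial>lborel)"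
    by (rule lborel_pair.Fubini'[symmetric]) measurable
  also have "\<dots> = (\<integral>\<^sup>+a. emeasure lborel {x. a < f x} * indicator {0<..} a \<partial>lborel)"
  proof (rule nn_integral_cong)
    fix a :: real
    have "(\<integral>\<^sup>+x. indicator {(x, a). 0 < a \<and> a < f x} (x, a) \<partial>lborel)
        = (\<integral>\<^sup>+x. indicator {0<..} a * indicator {x. a < f x} x \<partial>lborel)"
      by (intro nn_integral_cong) (auto simp: indicator_def)
    also have "\<dots> = indicator {0<..} a * emeasure lborel {x. a < f x}"
      by (subst nn_integral_cmult_indicator) auto
    finally show "(\<integral>\<^sup>+x. indicator {(x, a). 0 < a \<and> a < f x} (x, a) \<partial>lborel)
        = emeasure lborel {x. a < f x} * indicator {0<..} a" by (simp add: mult.commute)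
  qed
  finally show ?thesis .
qed

text \<open>With both suprema equal to 1, the superlevel sets of \<open>f\<close> and
  \<open>g\<close> at a height \<open>a\<close> are nonempty for \<open>a < 1\<close> and empty for
  \<open>a \<ge> 1\<close>. They are therefore never empty in only one of the two, and the
  one-dimensional Brunn-Minkowski inequality can be integrated over all positive heights.\<close>

lemma nn_integral_add_le_of_sup_one:
  fixes f g h :: "real \<Rightarrow> real"
  assumes [measurable]: "f \<in> borel_measurable borel" "g \<in> borel_measurable borel" "h \<in> borel_measurable borel"
    and f: "\<And>x. f x \<le> 1" "\<And>a. a < 1 \<Longrightarrow> \<exists>x. a < f x"
    and g: "\<And>x. g x \<le> 1" "\<And>a. a < 1 \<Longrightarrow> \<exists>x. a < g x"
    and t: "0 < t" "t < 1"
    and h: "\<And>x y. f x powr t * g y powr (1 - t) \<le> h (x + y)"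
  shows "(\<integral>\<^sup>+x. ennreal (f x) \<partial>lborel) + (\<integral>\<^sup>+x. ennreal (g x) \<partial>lborel) \<le> (\<integral>\<^sup>+x. ennreal (h x) \<partial>lborel)"
proof -
  have "emeasure lborel {x. a < f x} + emeasure lborel {x. a < g x} \<le> emeasure lborel {x. a < h x}"
    if "0 < a" for a
  proof (cases "a < 1")
    case False
    then have "{x. a < f x} = {}" "{x. a < g x} = {}"
      using f(1) g(1) by (auto simp: not_less intro: order_trans)
    then show ?thesis by simp
  next
    case True
    show ?thesis
    proof (rule brunn_minkowski_real)
      show "{x. a < f x} \<noteq> {}" "{x. a < g x} \<noteq> {}" using f(2) g(2) True by auto
      fix x y assume "x \<in> {x. a < f x}" "y \<in> {x. a < g x}"
      \<comment> \<open>Using the same height for both functions makes its weighted geometric mean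
        equal to \<open>a\<close> again.\<close>
      then have "a powr t * a powr (1 - t) < f x powr t * g y powr (1 - t)"
        using that t by (intro mult_strict_mono powr_less_mono2) auto
      also have "a powr t * a powr (1 - t) = a"
        using that by (simp flip: powr_add)
      also note h[of x y]
      finally show "x + y \<in> {x. a < h x}" by simp
    qed measurable
  qed
  then show ?thesis
    unfolding nn_integral_layer_cake[OF assms(1)] nn_integral_layer_cake[OF assms(2)] nn_integral_layer_cake[OF assms(3)]
    by (subst nn_integral_add[symmetric])
      (auto intro!: nn_integral_mono simp: indicator_def)
qed

lemma weighted_arith_geo_mean:
  fixes a b t :: real
  assumes "0 \<le> a" "0 \<le> b" "0 < t" "t < 1"
  shows "a powr t * b powr (1 - t) \<le> t * a + (1 - t) * b"
  using Youngs_inequality_0[of t "1 - t" a b] assms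
  by (cases "a = 0 \<or> b = 0") auto

text \<open>Dividing by the suprema and dilating the variables by \<open>t\<close> and
  \<open>1 - t\<close> reduces this to the additive inequality for functions with supremum 1. The
  dilations produce the weights \<open>t\<close> and \<open>1 - t\<close> in front of the integrals,
  and the arithmetic-geometric mean inequality turns the weighted sum back into a product.\<close>

theorem prekopa_leindler_real:
  fixes f g h :: "real \<Rightarrow> real"
  assumes int: "integrable lborel f" "integrable lborel g" "integrable lborel h"
    and nonneg: "\<And>x. 0 \<le> f x" "\<And>x. 0 \<le> g x" "\<And>x. 0 \<le> h x"
    and bdd: "bdd_above (range f)" "bdd_above (range g)"
    and t: "0 < t" "t < 1"
    and h: "\<And>x y. f x powr t * g y powr (1 - t) \<le> h (t * x + (1 - t) * y)"
  shows "integral\<^sup>L lborel f powr t * integral\<^sup>L lborel g powr (1 - t) \<le> integral\<^sup>L lborel h"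
proof -
  define M where "M = (SUP x. f x)"
  define N where "N = (SUP x. g x)"
  have fM: "f x \<le> M" for x unfolding M_def using bdd by (auto intro: cSUP_upper)
  have gN: "g x \<le> N" for x unfolding N_def using bdd by (auto intro: cSUP_upper)
  have hint: "0 \<le> integral\<^sup>L lborel h" using nonneg by simp
  have "0 \<le> M" "0 \<le> N" using fM gN nonneg order_trans by blast+
  show ?thesis
  proof (cases "M = 0 \<or> N = 0")
    \<comment> \<open>A zero supremum makes that function vanish identically, and the left side is 0
      because \<open>0 powr t = 0\<close>.\<close>
    case True
    then have "(\<forall>x. f x = 0) \<or> (\<forall>x. g x = 0)"
      using fM gN nonneg by (metis antisym)
    then have "f = (\<lambda>_. 0) \<or> g = (\<lambda>_. 0)"
      by (simp add: fun_eq_iff)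
    then have "integral\<^sup>L lborel f = 0 \<or> integral\<^sup>L lborel g = 0"
      by (elim disjE) simp_all
    then show ?thesis using hint by auto
  next
    case False
    then have pos: "0 < M" "0 < N" using \<open>0 \<le> M\<close> \<open>0 \<le> N\<close> by auto
    define C where "C = M powr t * N powr (1 - t)"
    have C: "0 < C" using pos by (simp add: C_def)
    have [measurable]: "f \<in> borel_measurable borel" "g \<in> borel_measurable borel" "h \<in> borel_measurable borel"
      using int[THEN borel_measurable_integrable] by simp_all
    \<comment> \<open>This is \<open>f (x / t) / M\<close>; the summand 0 matches the affine
      substitution rule for integrals.\<close>
    define f' where "f' = (\<lambda>x. f (0 + inverse t * x) / M)"
    define g' where "g' = (\<lambda>x. g (0 + inverse (1 - t) * x) / N)"
    define h' where "h' = (\<lambda>x. h x / C)"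
    have [measurable]: "f' \<in> borel_measurable borel" "g' \<in> borel_measurable borel" "h' \<in> borel_measurable borel"
      unfolding f'_def g'_def h'_def by measurable
    have int': "integrable lborel f'" "integrable lborel g'" "integrable lborel h'"
      unfolding f'_def g'_def h'_def using int t
        lborel_integrable_real_affine[of f "inverse t" 0] lborel_integrable_real_affine[of g "inverse (1 - t)" 0]
      by auto
    have nonneg': "\<And>x. 0 \<le> f' x" "\<And>x. 0 \<le> g' x" "\<And>x. 0 \<le> h' x"
      using nonneg pos C by (auto simp: f'_def g'_def h'_def)
    have If: "integral\<^sup>L lborel f' = t * (integral\<^sup>L lborel f / M)"
      using lborel_integral_real_affine[of "inverse t" f 0] t by (simp add: f'_def field_simps)
    have Ig: "integral\<^sup>L lborel g' = (1 - t) * (integral\<^sup>L lborel g / N)"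
      using lborel_integral_real_affine[of "inverse (1 - t)" g 0] t by (simp add: g'_def field_simps)
    have Ih: "integral\<^sup>L lborel h' = integral\<^sup>L lborel h / C"
      by (simp add: h'_def)
    have "(\<integral>\<^sup>+x. ennreal (f' x) \<partial>lborel) + (\<integral>\<^sup>+x. ennreal (g' x) \<partial>lborel) \<le> (\<integral>\<^sup>+x. ennreal (h' x) \<partial>lborel)"
    proof (rule nn_integral_add_le_of_sup_one[OF _ _ _ _ _ _ _ t])
      show "f' x \<le> 1" "g' x \<le> 1" for x using fM gN pos by (auto simp: f'_def g'_def)
      show "\<exists>x. a < f' x" if "a < 1" for a
      proof -
        have "a * M < M" using that pos by simp
        then obtain x where "a * M < f x"
          using bdd unfolding M_def by (subst (asm) less_cSUP_iff) auto
        \<comment> \<open>The point \<open>t * x\<close> undoes the dilation in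
          \<open>f'\<close>.\<close>
        then have "a < f' (t * x)" using pos t by (simp add: f'_def pos_less_divide_eq flip: mult.assoc)
        then show ?thesis by blast
      qed
      show "\<exists>x. a < g' x" if "a < 1" for a
      proof -
        have "a * N < N" using that pos by simp
        then obtain x where "a * N < g x"
          using bdd unfolding N_def by (subst (asm) less_cSUP_iff) auto
        then have "a < g' ((1 - t) * x)" using pos t by (simp add: g'_def pos_less_divide_eq flip: mult.assoc)
        then show ?thesis by blast
      qed
      fix x y
      have "t * (inverse t * x) + (1 - t) * (inverse (1 - t) * y) = x + y"
        using t by (simp flip: mult.assoc)
      then show "f' x powr t * g' y powr (1 - t) \<le> h' (x + y)"
        using h[of "inverse t * x" "inverse (1 - t) * y"] pos C nonneg
        by (simp add: f'_def g'_def h'_def powr_divide C_def divide_right_mono)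
    qed measurable
    then have "integral\<^sup>L lborel f' + integral\<^sup>L lborel g' \<le> integral\<^sup>L lborel h'"
      using int' nonneg' by (simp add: nn_integral_eq_integral flip: ennreal_plus)
    then have *: "t * (integral\<^sup>L lborel f / M) + (1 - t) * (integral\<^sup>L lborel g / N) \<le> integral\<^sup>L lborel h / C"
      by (simp only: If Ig Ih)
    have "integral\<^sup>L lborel f powr t * integral\<^sup>L lborel g powr (1 - t)
        = C * ((integral\<^sup>L lborel f / M) powr t * (integral\<^sup>L lborel g / N) powr (1 - t))"
      using pos nonneg by (simp add: powr_divide C_def)
    \<comment> \<open>The arithmetic-geometric mean inequality is applied to the normalised
      integrals, so \<open>C\<close> cancels afterwards.\<close>
    also have "\<dots> \<le> C * (integral\<^sup>L lborel h / C)"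
      using weighted_arith_geo_mean[OF _ _ t, of "integral\<^sup>L lborel f / M" "integral\<^sup>L lborel g / N"] * pos nonneg C
      by (intro mult_left_mono) auto
    finally show ?thesis using C by simp
  qed
qed

section \<open>Log-concave functions: superlevel sets, measurability and bounds\<close>

lemma log_concave_fun_nonneg: "log_concave_fun f \<Longrightarrow> 0 \<le> f x"
  by (simp add: log_concave_fun_def)

text \<open>The multiplicative form avoids extended reals: if either value is 0, the left side is 0,
  and otherwise the logarithms on the left are finite.\<close>

lemma log_concave_funD:
  assumes f: "log_concave_fun f" and t: "0 < t" "t < 1"
  shows "f x powr t * f y powr (1 - t) \<le> f (t *\<^sub>R x + (1 - t) *\<^sub>R y)"
proof (cases "f x = 0 \<or> f y = 0")
  case True
  then show ?thesis using log_concave_fun_nonneg[OF f] by auto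
next
  case False
  let ?z = "t *\<^sub>R x + (1 - t) *\<^sub>R y"
  have pos: "0 < f x" "0 < f y"
    using False log_concave_fun_nonneg[OF f, of x] log_concave_fun_nonneg[OF f, of y] by auto
  have *: "ereal t * ext_ln (f x) + ereal (1 - t) * ext_ln (f y) \<le> ext_ln (f ?z)"
  proof -
    have "\<forall>x y t. 0 < t \<longrightarrow> t < 1 \<longrightarrow>
        ereal (1 - t) * ext_ln (f x) + ereal t * ext_ln (f y) \<le> ext_ln (f ((1 - t) *\<^sub>R x + t *\<^sub>R y))"
      using f by (simp add: log_concave_fun_def)
    \<comment> \<open>The definition puts its parameter on the second point, hence the instance
      \<open>1 - t\<close>.\<close>
    from this[rule_format, of "1 - t" x y] show ?thesis using t by simp
  qed
  show ?thesis
  proof (cases "f ?z = 0")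
    \<comment> \<open>A zero at \<open>?z\<close> would make the right side of \<open>*\<close>
      equal to \<open>-\<infinity>\<close> while its left side is finite.\<close>
    case True
    then show ?thesis using * pos by (simp add: ext_ln_def)
  next
    case nz: False
    then have z: "0 < f ?z" using log_concave_fun_nonneg[OF f, of ?z] by auto
    have "t * ln (f x) + (1 - t) * ln (f y) \<le> ln (f ?z)"
      using * pos z by (simp add: ext_ln_def)
    then have "exp (t * ln (f x) + (1 - t) * ln (f y)) \<le> f ?z"
      using z by (metis exp_le_cancel_iff exp_ln)
    then show ?thesis using pos by (simp add: powr_def exp_add)
  qed
qed

lemma log_concave_fun_superlevel:
  assumes f: "log_concave_fun f" and t: "0 < t" "t < 1"
    and "0 \<le> r" "0 \<le> s" "r \<le> f x" "s \<le> f y"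
  shows "r powr t * s powr (1 - t) \<le> f (t *\<^sub>R x + (1 - t) *\<^sub>R y)"
proof -
  have "r powr t * s powr (1 - t) \<le> f x powr t * f y powr (1 - t)"
    using assms by (intro mult_mono powr_mono2) auto
  then show ?thesis using log_concave_funD[OF f t, of x y] by linarith
qed

lemma convex_superlevel_log_concave:
  assumes f: "log_concave_fun f"
  shows "convex {x. s \<le> f x}"
proof (cases "s \<le> 0")
  \<comment> \<open>Nonpositive levels are split off since
    \<open>s powr u * s powr (1 - u) = s\<close> is used below for positive
    \<open>s\<close>.\<close>
  case True
  then have "{x. s \<le> f x} = UNIV"
    using log_concave_fun_nonneg[OF f] order_trans by blast
  then show ?thesis by simp
next
  case False
  show ?thesis
  proof (rule convexI)
    fix x y u v assume xy: "x \<in> {x. s \<le> f x}" "y \<in> {x. s \<le> f x}" and uv: "0 \<le> u" "0 \<le> v" "u + v = (1::real)"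
    show "u *\<^sub>R x + v *\<^sub>R y \<in> {x. s \<le> f x}"
    proof (cases "0 < u \<and> u < 1")
      case True
      have "s powr u * s powr (1 - u) = s" using False by (simp flip: powr_add)
      then show ?thesis
        using log_concave_fun_superlevel[OF f, of u s s x y] True False xy uv
        by (auto simp: eq_diff_eq[symmetric] add.commute)
    next
      case False
      then have "u = 0 \<and> v = 1 \<or> u = 1 \<and> v = 0" using uv by auto
      then show ?thesis using xy by auto
    qed
  qed
qed

text \<open>A convex set is its open interior together with a subset of its frontier, which is
  Lebesgue-null. Completeness of \<open>lebesgue\<close> matters here, since a convex set need not
  be Borel.\<close>

lemma sets_lebesgue_convex:
  fixes S :: "'a::euclidean_space set"
  assumes "convex S"
  shows "S \<in> sets lebesgue"
proof -
  have "S \<inter> frontier S \<in> null_sets lebesgue"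
    using negligible_convex_frontier[OF assms] negligible_subset
    by (metis Int_lower2 negligible_iff_null_sets)
  then have "interior S \<union> (S \<inter> frontier S) \<in> sets lebesgue" by auto
  moreover have "interior S \<union> (S \<inter> frontier S) = S"
    using interior_subset[of S] closure_subset[of S] unfolding frontier_def by blast
  ultimately show ?thesis by simp
qed

lemma borel_measurable_log_concave:
  assumes "log_concave_fun f"
  shows "f \<in> borel_measurable lebesgue"
  unfolding borel_measurable_iff_ge
  using sets_lebesgue_convex[OF convex_superlevel_log_concave[OF assms]] by simp

text \<open>The origin is the midpoint of \<open>x\<close> and \<open>-x\<close>, at which
  \<open>f\<close> takes equal values.\<close>

lemma even_log_concave_le:
  assumes "even_fun f" "log_concave_fun f"
  shows "f x \<le> f 0"
proof -
  have "f x powr (1/2) * f (-x) powr (1 - 1/2) \<le> f 0"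
    using log_concave_funD[OF assms(2), of "1/2" x "-x"] by simp
  moreover have "f (-x) = f x" using assms by (simp add: even_fun_def)
  ultimately show ?thesis
    using log_concave_fun_nonneg[OF assms(2), of x] by (simp flip: powr_add)
qed

section \<open>Symmetric convex bodies, support functions and logarithmic sums\<close>

lemma measure_closure_convex:
  fixes S :: "'a::euclidean_space set"
  assumes "convex S" "bounded S"
  shows "measure lebesgue (closure S) = measure lebesgue S"
  using assms by (intro measure_closure negligible_convex_frontier)

lemma zero_in_symmetric_convex:
  fixes S :: "'a::real_vector set"
  assumes "convex S" "S \<noteq> {}" "S = uminus ` S"
  shows "0 \<in> S"
proof -
  obtain x where "x \<in> S" using assms by auto
  then have "-x \<in> S" using assms by blast
  then have "(1/2) *\<^sub>R x + (1/2) *\<^sub>R (-x) \<in> S"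
    using \<open>x \<in> S\<close> assms by (intro convexD) auto
  then show ?thesis by simp
qed

lemma symmetric_body_imp_zero: "symmetric_body K \<Longrightarrow> 0 \<in> K"
  using zero_in_symmetric_convex[of K] interior_subset[of K]
  by (auto simp: symmetric_body_def convex_body_def)

lemma support_function_upper:
  assumes "compact K" "y \<in> K"
  shows "u \<bullet> y \<le> support_function K u"
  unfolding support_function_def
proof (rule cSUP_upper)
  have "compact ((\<lambda>y. u \<bullet> y) ` K)"
    using assms by (intro compact_continuous_image continuous_intros)
  then show "bdd_above ((\<lambda>y. u \<bullet> y) ` K)" by (simp add: compact_imp_bounded bounded_imp_bdd_above)
qed fact

lemma support_function_nonneg:
  assumes "compact K" "0 \<in> K"
  shows "0 \<le> support_function K u"
  using support_function_upper[OF assms, of u] by simp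

lemma support_function_mono:
  assumes "A \<noteq> {}" "A \<subseteq> K" "compact K"
  shows "support_function A u \<le> support_function K u"
  unfolding support_function_def[of A]
  using assms support_function_upper by (intro cSUP_least) auto

text \<open>Support functions grow with the body. The origin lies in the bodies to make them
  nonnegative, so that \<open>powr\<close> is monotone on their values.\<close>

lemma log_sum_mono:
  assumes "0 < t" "t < 1" "A \<subseteq> K" "B \<subseteq> L" "0 \<in> A" "0 \<in> B" "compact A" "compact B" "compact K" "compact L"
  shows "log_sum t A B \<subseteq> log_sum t K L"
proof -
  have "support_function A u powr t * support_function B u powr (1 - t)
      \<le> support_function K u powr t * support_function L u powr (1 - t)" for u
    using assms by (intro mult_mono powr_mono2 support_function_mono support_function_nonneg) auto
  then show ?thesis unfolding log_sum_def by (fast intro: order_trans)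
qed

text \<open>The support function of the Minkowski combination is the weighted arithmetic mean of the
  two support functions, which dominates the geometric mean defining \<open>log_sum\<close>. A point
  outside the combination is separated from it by a hyperplane, whose normal violates this
  bound.\<close>

lemma log_sum_subset_minkowski:
  assumes t: "0 < t" "t < 1" and A: "convex_body A" "0 \<in> A" and B: "convex_body B" "0 \<in> B"
  shows "log_sum t A B \<subseteq> {t *\<^sub>R a + (1 - t) *\<^sub>R b | a b. a \<in> A \<and> b \<in> B}"
proof
  fix x assume x: "x \<in> log_sum t A B"
  let ?C = "{t *\<^sub>R a + (1 - t) *\<^sub>R b | a b. a \<in> A \<and> b \<in> B}"
  have eq: "?C = {p + q | p q. p \<in> (*\<^sub>R) t ` A \<and> q \<in> (*\<^sub>R) (1 - t) ` B}" by auto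
  show "x \<in> ?C"
  proof (rule ccontr)
    assume "x \<notin> ?C"
    moreover have "compact ?C"
      unfolding eq using A B by (intro compact_sums compact_scaling) (auto simp: convex_body_def)
    moreover have "convex ?C"
    proof -
      have "?C = (\<Union>p\<in>(*\<^sub>R) t ` A. \<Union>q\<in>(*\<^sub>R) (1 - t) ` B. {p + q})" by auto
      also have "convex \<dots>"
        using A B by (intro convex_sums convex_scaling) (auto simp: convex_body_def)
      finally show ?thesis .
    qed
    ultimately obtain v c where v: "v \<bullet> x < c" "\<forall>y\<in>?C. c < v \<bullet> y"
      using separating_hyperplane_closed_point[OF _ compact_imp_closed] by blast
    \<comment> \<open>The origin lies in \<open>?C\<close>, and evaluating the separation there
      rules out \<open>v = 0\<close>.\<close>
    have "t *\<^sub>R 0 + (1 - t) *\<^sub>R 0 \<in> ?C" using A B by blast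
    then have "c < v \<bullet> (t *\<^sub>R 0 + (1 - t) *\<^sub>R 0)" using v by blast
    then have "v \<noteq> 0" using v(1) by auto
    \<comment> \<open>The separation bounds \<open>?C\<close> from below along \<open>v\<close>, so
      the outward unit normal is the normalised \<open>-v\<close>.\<close>
    define u where "u = - (v /\<^sub>R norm v)"
    have u: "u \<in> sphere 0 1" using \<open>v \<noteq> 0\<close> by (simp add: u_def)
    obtain a where a: "a \<in> A" "support_function A u = u \<bullet> a"
      using support_function_attained[OF A(1)] by blast
    obtain b where b: "b \<in> B" "support_function B u = u \<bullet> b"
      using support_function_attained[OF B(1)] by blast
    have comp: "compact A" "compact B" using A B by (auto simp: convex_body_def)
    have "x \<bullet> u \<le> support_function A u powr t * support_function B u powr (1 - t)"
      using x u by (auto simp: log_sum_def)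
    also have "\<dots> \<le> t * support_function A u + (1 - t) * support_function B u"
      using t A B comp by (intro weighted_arith_geo_mean support_function_nonneg)
    also have "\<dots> = u \<bullet> (t *\<^sub>R a + (1 - t) *\<^sub>R b)"
      using a b by (simp add: inner_add_right)
    finally have "u \<bullet> x \<le> u \<bullet> (t *\<^sub>R a + (1 - t) *\<^sub>R b)" by (simp add: inner_commute)
    moreover have "v \<bullet> x < v \<bullet> (t *\<^sub>R a + (1 - t) *\<^sub>R b)"
    proof -
      have "t *\<^sub>R a + (1 - t) *\<^sub>R b \<in> ?C" using a b by blast
      then show ?thesis using v by fastforce
    qed
    ultimately show False using \<open>v \<noteq> 0\<close> by (simp add: u_def)
  qed
qed

text \<open>The logarithmic sum is an intersection of closed half-spaces, and it is bounded because
  the Minkowski combination is.\<close>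

lemma compact_log_sum:
  assumes t: "0 < t" "t < 1" and A: "convex_body A" "0 \<in> A" and B: "convex_body B" "0 \<in> B"
  shows "compact (log_sum t A B)"
proof -
  let ?C = "{p + q | p q. p \<in> (*\<^sub>R) t ` A \<and> q \<in> (*\<^sub>R) (1 - t) ` B}"
  have "compact ?C"
    using A B by (intro compact_sums compact_scaling) (auto simp: convex_body_def)
  moreover have "log_sum t A B \<subseteq> ?C"
    using log_sum_subset_minkowski[OF assms] by blast
  moreover have "closed (log_sum t A B)"
  proof -
    have "log_sum t A B = (\<Inter>u\<in>sphere 0 1. {x. u \<bullet> x \<le> support_function A u powr t * support_function B u powr (1 - t)})"
      by (auto simp: log_sum_def inner_commute)
    then show ?thesis by (simp add: closed_halfspace_le closed_INT)
  qed
  ultimately show ?thesis 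
    by (meson bounded_subset compact_eq_bounded_closed)
qed

text \<open>A convex set with empty interior is null, so positive measure provides the interior that
  a body needs; taking the closure provides compactness.\<close>

lemma symmetric_body_closure:
  assumes "convex S" "bounded S" "S = uminus ` S" "0 < measure lebesgue S"
  shows "symmetric_body (closure S)"
proof -
  have "interior S \<noteq> {}"
  proof
    assume "interior S = {}"
    then have "negligible S"
      using assms negligible_convex_interior by blast
    then show False using assms by (simp add: negligible_imp_measure0)
  qed
  then have "interior (closure S) \<noteq> {}"
    using interior_mono[OF closure_subset, of S] by auto
  moreover have "closure S = uminus ` closure S"
    using closure_scaleR[of "-1" S] assms(3) by (simp add: scaleR_minus1_left[abs_def])
  ultimately show ?thesis using assms
    by (auto simp: symmetric_body_def convex_body_def convex_closure)
qed

section \<open>Measures with a density as integrals over exponential levels\<close>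

lemma sigma_finite_lebesgue: "sigma_finite_measure (lebesgue :: 'a::euclidean_space measure)"
proof
  show "\<exists>A::'a set set. countable A \<and> A \<subseteq> sets lebesgue \<and> \<Union>A = space lebesgue \<and> (\<forall>a\<in>A. emeasure lebesgue a \<noteq> \<infinity>)"
    by (intro exI[of _ "range (\<lambda>n::nat. box (- real n *\<^sub>R One) (real n *\<^sub>R One))"])
       (auto simp: emeasure_lborel_box_eq UN_box_eq_UNIV)
qed

text \<open>Pointwise, a positive value \<open>f y\<close> is the integral of
  \<open>exp (-x)\<close> over \<open>x \<ge> - ln (f y)\<close>. Levels are parametrised as
  \<open>exp (-x)\<close> so that geometric means of levels become convex combinations of the
  parameters.\<close>

lemma emeasure_density_exp_layers:
  fixes f :: "'a::euclidean_space \<Rightarrow> real"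
  assumes f[measurable]: "f \<in> borel_measurable lebesgue" and nonneg: "\<And>y. 0 \<le> f y" and S: "S \<in> lmeasurable"
  shows "emeasure (density lebesgue (\<lambda>x. ennreal (f x))) S
      = (\<integral>\<^sup>+x. ennreal (exp (-x) * measure lebesgue (S \<inter> {y. exp (-x) \<le> f y})) \<partial>lborel)"
proof -
  have [measurable]: "S \<in> sets lebesgue" using S by auto
  interpret P: pair_sigma_finite lborel "lebesgue :: 'a measure"
    by (simp add: pair_sigma_finite_def sigma_finite_lebesgue sigma_finite_lborel)
  let ?k = "\<lambda>x y. ennreal (exp (-x)) * indicator {(x, y). y \<in> S \<and> exp (-x) \<le> f y} (x, y)"
  have "emeasure (density lebesgue (\<lambda>x. ennreal (f x))) S
      = (\<integral>\<^sup>+y. ennreal (f y) * indicator S y \<partial>lebesgue)"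
    by (subst emeasure_density) auto
  also have "\<dots> = (\<integral>\<^sup>+y. (\<integral>\<^sup>+x. ?k x y \<partial>lborel) \<partial>lebesgue)"
  proof (rule nn_integral_cong)
    fix y
    show "ennreal (f y) * indicator S y = (\<integral>\<^sup>+x. ?k x y \<partial>lborel)"
    proof (cases "y \<in> S \<and> 0 < f y")
      case True
      have le: "exp (-x) \<le> f y \<longleftrightarrow> - ln (f y) \<le> x" for x
        using True ln_ge_iff[of "f y" "-x"] by auto
      have "((\<lambda>x::real. - exp (-x)) \<longlongrightarrow> 0) at_top"
        using tendsto_minus[OF filterlim_compose[OF exp_at_bot filterlim_uminus_at_bot_at_top]] by simp
      \<comment> \<open>The antiderivative is \<open>- exp (-x)\<close>, which tends to 0 at
        infinity.\<close>
      then have "(\<integral>\<^sup>+x. ennreal (exp (-x)) * indicator {- ln (f y)..} x \<partial>lborel) = ennreal (0 - - exp (- (- ln (f y))))"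
        by (intro nn_integral_FTC_atLeast) (auto intro!: derivative_eq_intros)
      also have "\<dots> = ennreal (f y)" using True by simp
      also have "(\<integral>\<^sup>+x. ennreal (exp (-x)) * indicator {- ln (f y)..} x \<partial>lborel) = (\<integral>\<^sup>+x. ?k x y \<partial>lborel)"
        using True by (intro nn_integral_cong) (auto simp: indicator_def le)
      finally show ?thesis using True by simp
    next
      case False
      \<comment> \<open>Every level \<open>exp (-x)\<close> is positive, so a point with
        \<open>f y \<le> 0\<close> is in no layer.\<close>
      then have "?k x y = 0" for x
        using exp_gt_zero[of "-x"] by (auto simp: indicator_def simp del: exp_gt_zero)
      then have "(\<integral>\<^sup>+x. ?k x y \<partial>lborel) = 0" by simp
      moreover have "ennreal (f y) * indicator S y = 0"
        using False nonneg[of y] by (auto simp: indicator_def ennreal_eq_0_iff)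
      ultimately show ?thesis by simp
    qed
  qed
  also have "\<dots> = (\<integral>\<^sup>+x. (\<integral>\<^sup>+y. ?k x y \<partial>lebesgue) \<partial>lborel)"
    by (rule P.Fubini') measurable
  also have "\<dots> = (\<integral>\<^sup>+x. ennreal (exp (-x) * measure lebesgue (S \<inter> {y. exp (-x) \<le> f y})) \<partial>lborel)"
  proof (rule nn_integral_cong)
    fix x :: real
    have m: "S \<inter> {y. exp (-x) \<le> f y} \<in> lmeasurable"
    proof (rule fmeasurable_Int_fmeasurable[OF S])
      have "{y \<in> space lebesgue. exp (-x) \<le> f y} \<in> sets lebesgue" by measurable
      then show "{y. exp (-x) \<le> f y} \<in> sets lebesgue" by simp
    qed
    have "(\<integral>\<^sup>+y. ?k x y \<partial>lebesgue) = (\<integral>\<^sup>+y. ennreal (exp (-x)) * indicator (S \<inter> {y. exp (-x) \<le> f y}) y \<partial>lebesgue)"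
      by (intro nn_integral_cong) (auto simp: indicator_def)
    also have "\<dots> = ennreal (exp (-x)) * emeasure lebesgue (S \<inter> {y. exp (-x) \<le> f y})"
      using m by (intro nn_integral_cmult_indicator) auto
    also have "\<dots> = ennreal (exp (-x) * measure lebesgue (S \<inter> {y. exp (-x) \<le> f y}))"
      using m by (simp add: emeasure_eq_measure2 ennreal_mult)
    finally show "(\<integral>\<^sup>+y. ?k x y \<partial>lebesgue) = \<dots>" .
  qed
  finally show ?thesis .
qed

section \<open>Logarithmic sums of bodies truncated to superlevel sets\<close>

lemma log_concave_closure_superlevels:
  fixes f :: "'a::euclidean_space \<Rightarrow> real"
  assumes f: "log_concave_fun f" and t: "0 < t" "t < 1" and "0 \<le> r" "0 \<le> s"
    and "a \<in> closure {x. r \<le> f x}" "b \<in> closure {x. s \<le> f x}"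
  shows "t *\<^sub>R a + (1 - t) *\<^sub>R b \<in> closure {x. r powr t * s powr (1 - t) \<le> f x}"
proof -
  let ?P = "{x. r \<le> f x} \<times> {x. s \<le> f x}"
  \<comment> \<open>The inclusion for the superlevel sets themselves passes to closures because the
    combination map is continuous on the product.\<close>
  have "(\<lambda>(a, b). t *\<^sub>R a + (1 - t) *\<^sub>R b) ` closure ?P \<subseteq> closure {x. r powr t * s powr (1 - t) \<le> f x}"
  proof (rule image_closure_subset)
    show "continuous_on (closure ?P) (\<lambda>(a, b). t *\<^sub>R a + (1 - t) *\<^sub>R b)"
      by (auto simp: case_prod_unfold intro!: continuous_intros)
    show "(\<lambda>(a, b). t *\<^sub>R a + (1 - t) *\<^sub>R b) ` ?P \<subseteq> closure {x. r powr t * s powr (1 - t) \<le> f x}"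
      using log_concave_fun_superlevel[OF f t] assms closure_subset by fastforce
  qed simp
  moreover have "(a, b) \<in> closure ?P" using assms by (simp add: closure_Times)
  ultimately show ?thesis by fast
qed

text \<open>The truncated sets need not be closed, so the assumed inequality is applied to their
  closures, which have the same measure. This is possible when both measures are positive; otherwise
  the left side is 0.\<close>

lemma measure_log_sum_superlevels:
  fixes f :: "'a::euclidean_space \<Rightarrow> real"
  assumes lbm: "log_brunn_minkowski (lebesgue :: 'a measure)"
    and even: "even_fun f" and f: "log_concave_fun f"
    and K: "symmetric_body K" and L: "symmetric_body L"
    and t: "0 < t" "t < 1" and rs: "0 \<le> r" "0 \<le> s"
  shows "measure lebesgue (K \<inter> {x. r \<le> f x}) powr t * measure lebesgue (L \<inter> {x. s \<le> f x}) powr (1 - t)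
    \<le> measure lebesgue (log_sum t K L \<inter> {x. r powr t * s powr (1 - t) \<le> f x})"
proof (cases "measure lebesgue (K \<inter> {x. r \<le> f x}) = 0 \<or> measure lebesgue (L \<inter> {x. s \<le> f x}) = 0")
  case True
  then show ?thesis by auto
next
  case False
  let ?E = "{x. r powr t * s powr (1 - t) \<le> f x}"
  let ?A = "closure (K \<inter> {x. r \<le> f x})"
  let ?B = "closure (L \<inter> {x. s \<le> f x})"
  have body: "symmetric_body (closure (M \<inter> {x. c \<le> f x}))"
      "measure lebesgue (closure (M \<inter> {x. c \<le> f x})) = measure lebesgue (M \<inter> {x. c \<le> f x})"
      "closure (M \<inter> {x. c \<le> f x}) \<subseteq> M" "closure (M \<inter> {x. c \<le> f x}) \<subseteq> closure {x. c \<le> f x}"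
    if M: "symmetric_body M" and pos: "measure lebesgue (M \<inter> {x. c \<le> f x}) \<noteq> 0" for M c
  proof -
    let ?T = "M \<inter> {x. c \<le> f x}"
    have M': "compact M" "convex M" "M = uminus ` M"
      using M unfolding symmetric_body_def convex_body_def by blast+
    have conv: "convex ?T"
      using M' convex_superlevel_log_concave[OF f] by (simp add: convex_Int)
    have bdd: "bounded ?T" using M' by (simp add: bounded_Int compact_imp_bounded)
    have neg: "- x \<in> ?T" if "x \<in> ?T" for x
      using that M'(3) even by (auto simp: even_fun_def)
    have sym: "?T = uminus ` ?T"
    proof
      show "?T \<subseteq> uminus ` ?T"
      proof
        fix x assume "x \<in> ?T"
        then have "- (- x) \<in> uminus ` ?T" using neg by blast
        then show "x \<in> uminus ` ?T" by simp
      qed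
      show "uminus ` ?T \<subseteq> ?T" using neg by blast
    qed
    have "0 < measure lebesgue ?T" using pos by (simp add: less_le)
    then show "symmetric_body (closure ?T)" by (rule symmetric_body_closure[OF conv bdd sym])
    show "measure lebesgue (closure ?T) = measure lebesgue ?T" by (rule measure_closure_convex[OF conv bdd])
    show "closure ?T \<subseteq> M" using M' by (intro closure_minimal) (auto simp: compact_imp_closed)
    show "closure ?T \<subseteq> closure {x. c \<le> f x}" by (intro closure_mono) auto
  qed
  have A: "symmetric_body ?A" "measure lebesgue ?A = measure lebesgue (K \<inter> {x. r \<le> f x})"
      "?A \<subseteq> K" "?A \<subseteq> closure {x. r \<le> f x}"
    using body[OF K] False by blast+
  have B: "symmetric_body ?B" "measure lebesgue ?B = measure lebesgue (L \<inter> {x. s \<le> f x})"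
      "?B \<subseteq> L" "?B \<subseteq> closure {x. s \<le> f x}"
    using body[OF L] False by blast+
  have cb: "convex_body ?A" "convex_body ?B" "convex_body K" "convex_body L"
    using A B K L by (auto simp: symmetric_body_def)
  then have comp: "compact ?A" "compact ?B" "compact K" "compact L"
    unfolding convex_body_def by blast+
  have zero: "0 \<in> ?A" "0 \<in> ?B" "0 \<in> K" "0 \<in> L"
    using A B K L symmetric_body_imp_zero by blast+
  have sub: "log_sum t ?A ?B \<subseteq> log_sum t K L \<inter> closure ?E"
  proof (rule Int_greatest)
    show "log_sum t ?A ?B \<subseteq> log_sum t K L"
      using log_sum_mono[OF t A(3) B(3) zero(1,2) comp] .
    show "log_sum t ?A ?B \<subseteq> closure ?E"
    proof
      fix x assume "x \<in> log_sum t ?A ?B"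
      then obtain a b where "a \<in> ?A" "b \<in> ?B" "x = t *\<^sub>R a + (1 - t) *\<^sub>R b"
        using log_sum_subset_minkowski[OF t cb(1) zero(1) cb(2) zero(2)] by blast
      then show "x \<in> closure ?E"
        using log_concave_closure_superlevels[OF f t rs] A(4) B(4) by blast
    qed
  qed
  have LS: "compact (log_sum t K L)" by (rule compact_log_sum[OF t cb(3) zero(3) cb(4) zero(4)])
  then have fin: "log_sum t K L \<inter> closure ?E \<in> lmeasurable"
    by (intro lmeasurable_compact compact_Int_closed) auto
  have "measure lebesgue (K \<inter> {x. r \<le> f x}) powr t * measure lebesgue (L \<inter> {x. s \<le> f x}) powr (1 - t)
      = measure lebesgue ?A powr t * measure lebesgue ?B powr (1 - t)"
    by (simp only: A(2) B(2))
  also have "\<dots> \<le> measure lebesgue (log_sum t ?A ?B)"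
    using lbm A(1) B(1) t unfolding log_brunn_minkowski_def by blast
  also have "\<dots> \<le> measure lebesgue (log_sum t K L \<inter> closure ?E)"
    using sub fin compact_log_sum[OF t cb(1) zero(1) cb(2) zero(2)]
    by (intro measure_mono_fmeasurable) (auto simp: compact_imp_closed)
  also have "\<dots> = measure lebesgue (log_sum t K L \<inter> ?E)"
  \<comment> \<open>The two sets differ only inside the frontier of the convex set
    \<open>?E\<close>, which is negligible.\<close>
  proof (rule measure_negligible_symdiff[symmetric, OF fin])
    have "negligible (frontier ?E)"
      using negligible_convex_frontier convex_superlevel_log_concave[OF f] by blast
    then show "negligible (log_sum t K L \<inter> closure ?E - log_sum t K L \<inter> ?E \<union>
        (log_sum t K L \<inter> ?E - log_sum t K L \<inter> closure ?E))"
      using closure_subset[of ?E] interior_subset[of ?E]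
      by (elim negligible_subset) (unfold frontier_def, blast)
  qed
  finally show ?thesis .
qed

theorem theorem3p1:
  fixes f :: "real ^ 'n \<Rightarrow> real" and \<mu> :: "(real ^ 'n) measure"
  assumes "log_brunn_minkowski (lebesgue :: (real ^ 'n) measure)"
    and "even_fun f"
    and "log_concave_fun f"
    and "\<mu> = density lebesgue (\<lambda>x. ennreal (f x))"
  shows "log_brunn_minkowski \<mu>"
  unfolding log_brunn_minkowski_def
proof (intro allI impI)
  fix K L :: "(real ^ 'n) set" and t :: real
  assume K: "symmetric_body K" and L: "symmetric_body L" and t: "0 < t" "t < 1"
  note f_meas[measurable] = borel_measurable_log_concave[OF assms(3)]
  note nonneg = log_concave_fun_nonneg[OF assms(3)]
  \<comment> \<open>\<open>G S\<close> is the integrand of the exponential layer formula for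
    \<open>S\<close>; the following facts are what the Prekopa-Leindler inequality requires of
    it.\<close>
  define G where "G S x = exp (-x) * measure lebesgue (S \<inter> {y. exp (-x) \<le> f y})" for S x
  have G: "integrable lborel (G S)" "integral\<^sup>L lborel (G S) = measure \<mu> S" "bdd_above (range (G S))"
    if S: "compact S" for S
  proof -
    have Sm: "S \<in> lmeasurable" using S by (rule lmeasurable_compact)
    then have [measurable]: "S \<in> sets lebesgue" by auto
    have lev: "{y. exp (-x) \<le> f y} \<in> sets lebesgue" for x
      by (intro sets_lebesgue_convex convex_superlevel_log_concave assms)
    \<comment> \<open>Increasing \<open>x\<close> lowers the level and enlarges the truncated set;
      this monotonicity yields measurability in \<open>x\<close>.\<close>
    have "mono (\<lambda>x. measure lebesgue (S \<inter> {y. exp (-x) \<le> f y}))"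
    proof (intro monoI measure_mono_fmeasurable)
      fix x x' :: real assume "x \<le> x'"
      then have "exp (-x') \<le> exp (-x)" by simp
      then show "S \<inter> {y. exp (-x) \<le> f y} \<subseteq> S \<inter> {y. exp (-x') \<le> f y}"
        by (blast intro: order_trans)
      show "S \<inter> {y. exp (-x) \<le> f y} \<in> sets lebesgue" using lev by auto
      show "S \<inter> {y. exp (-x') \<le> f y} \<in> lmeasurable" using lev Sm by (intro fmeasurable_Int_fmeasurable)
    qed
    from borel_measurable_mono[OF this] have [measurable]: "G S \<in> borel_measurable borel"
      unfolding G_def[abs_def] by measurable
    have Gnn: "0 \<le> G S x" for x by (simp add: G_def)
    have em: "emeasure \<mu> S = (\<integral>\<^sup>+x. ennreal (G S x) \<partial>lborel)"
      unfolding assms(4) G_def by (rule emeasure_density_exp_layers[OF f_meas nonneg Sm])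
    have "emeasure \<mu> S = (\<integral>\<^sup>+y. ennreal (f y) * indicator S y \<partial>lebesgue)"
      unfolding assms(4) by (subst emeasure_density) auto
    \<comment> \<open>Bounding the density by its value at the origin makes the mass of the compact
      set \<open>S\<close> finite, hence \<open>G S\<close> integrable.\<close>
    also have "\<dots> \<le> (\<integral>\<^sup>+y. ennreal (f 0) * indicator S y \<partial>lebesgue)"
      using even_log_concave_le[OF assms(2,3)]
      by (intro nn_integral_mono mult_right_mono ennreal_leI) auto
    also have "\<dots> = ennreal (f 0) * emeasure lebesgue S"
      by (intro nn_integral_cmult_indicator) auto
    also have "\<dots> < \<infinity>"
      using Sm by (auto simp: ennreal_mult_less_top fmeasurable_def)
    finally have fin: "emeasure \<mu> S < \<infinity>" .
    show int: "integrable lborel (G S)"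
      using fin em Gnn by (intro integrableI_nonneg) auto
    show "integral\<^sup>L lborel (G S) = measure \<mu> S"
      using em Gnn by (subst integral_eq_nn_integral) (auto simp: measure_def)
    show "bdd_above (range (G S))"
    proof (rule bdd_aboveI2)
      fix x
      show "G S x \<le> f 0 * measure lebesgue S"
      \<comment> \<open>Above the maximal value \<open>f 0\<close> the superlevel set is empty;
        below it both factors of \<open>G S x\<close> are bounded.\<close>
      proof (cases "exp (-x) \<le> f 0")
        case True
        have "measure lebesgue (S \<inter> {y. exp (-x) \<le> f y}) \<le> measure lebesgue S"
          using lev Sm by (intro measure_mono_fmeasurable) auto
        then show ?thesis unfolding G_def using True nonneg by (intro mult_mono) auto
      next
        case False
        then have "{y. exp (-x) \<le> f y} = {}"
          using even_log_concave_le[OF assms(2,3)] order_trans by blast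
        then show ?thesis using nonneg[of 0] by (simp add: G_def)
      qed
    qed
  qed
  have cb: "convex_body K" "convex_body L" using K L by (auto simp: symmetric_body_def)
  then have comp: "compact K" "compact L" "compact (log_sum t K L)"
    using compact_log_sum[OF t cb(1) symmetric_body_imp_zero[OF K] cb(2) symmetric_body_imp_zero[OF L]]
    by (simp_all add: convex_body_def)
  have "integral\<^sup>L lborel (G K) powr t * integral\<^sup>L lborel (G L) powr (1 - t)
      \<le> integral\<^sup>L lborel (G (log_sum t K L))"
  proof (rule prekopa_leindler_real[OF G(1)[OF comp(1)] G(1)[OF comp(2)] G(1)[OF comp(3)] _ _ _
        G(3)[OF comp(1)] G(3)[OF comp(2)] t])
    show "0 \<le> G K x" "0 \<le> G L x" "0 \<le> G (log_sum t K L) x" for x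
      by (simp_all add: G_def)
    fix x y :: real
    \<comment> \<open>This identity serves twice: for the factor \<open>exp (-x)\<close> in
      \<open>G\<close> and for the level defining the truncation.\<close>
    have e: "exp (-x) powr t * exp (-y) powr (1 - t) = exp (- (t * x + (1 - t) * y))"
      by (simp add: powr_def algebra_simps flip: exp_add)
    have "G K x powr t * G L y powr (1 - t) = exp (- (t * x + (1 - t) * y)) *
        (measure lebesgue (K \<inter> {z. exp (-x) \<le> f z}) powr t * measure lebesgue (L \<inter> {z. exp (-y) \<le> f z}) powr (1 - t))"
      unfolding e[symmetric] by (simp add: G_def powr_mult)
    also have "\<dots> \<le> G (log_sum t K L) (t * x + (1 - t) * y)"
      unfolding G_def e[symmetric]
      by (intro mult_left_mono measure_log_sum_superlevels[OF assms(1-3) K L t]) auto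
    finally show "G K x powr t * G L y powr (1 - t) \<le> G (log_sum t K L) (t * x + (1 - t) * y)" .
  qed
  then show "measure \<mu> K powr t * measure \<mu> L powr (1 - t) \<le> measure \<mu> (log_sum t K L)"
    using G(2) comp by simp
qed

end
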